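(* Let $p,q$ be complex numbers. The generating function of the even-indexed $(p,q)$-Jacobsthal Lucas numbers is, as a formal power series in $z$, $$\sum_{n=0}^{\infty}j_{p,q,2n}z^n=\frac{2-(p^2+4q)z}{1-(p^2+4q)z+4q^2z^2}.$$
   Context: The $(p,q)$-Jacobsthal Lucas numbers are defined by $j_{p,q,0}=2$, $j_{p,q,1}=p$, and $j_{p,q,n}=pj_{p,q,n-1}+2qj_{p,q,n-2}$ for $n\ge 2$. *)

theory Defs
  imports Complex_Main "HOL-Computational_Algebra.Formal_Power_Series"
begin

fun jacobsthal_lucas :: "complex \<Rightarrow> complex \<Rightarrow> nat \<Rightarrow> complex" where
  "jacobsthal_lucas p q 0 = 2"
| "jacobsthal_lucas p q (Suc 0) = p"
| "jacobsthal_lucas p q (Suc (Suc n)) =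
     p * jacobsthal_lucas p q (Suc n) + 2 * q * jacobsthal_lucas p q n"

end

theory Submission
  imports Defs
begin

text \<open>The even-indexed terms satisfy a two-term recurrence of their own, whose coefficients
  are those of the denominator. Multiplying the series by the denominator therefore kills every
  coefficient from degree 2 on, and the initial values 2 and \<open>p\<^sup>2 + 4 * q\<close> leave
  exactly the numerator.\<close>

text \<open>Expand j(n+4), then j(n+3), by the recurrence and remove the odd-offset term through p
  j(n+1) = j(n+2) - 2q j(n).\<close>

lemma jacobsthal_lucas_add_4:
  "jacobsthal_lucas p q (n + 4) =
    (p\<^sup>2 + 4 * q) * jacobsthal_lucas p q (n + 2) - 4 * q\<^sup>2 * jacobsthal_lucas p q n"
  by (simp add: eval_nat_numeral algebra_simps)

theorem theorem10:
  fixes p q :: complex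
  shows "Abs_fps (\<lambda>n. jacobsthal_lucas p q (2 * n)) =
    (2 - fps_const (p\<^sup>2 + 4 * q) * fps_X) /
    (1 - fps_const (p\<^sup>2 + 4 * q) * fps_X + fps_const (4 * q\<^sup>2) * fps_X\<^sup>2)"
    (is "?F = ?N / ?D")
proof -
  have "?F * ?D = ?N"
  proof (rule fps_ext)
    fix n
    \<comment> \<open>With \<open>fps_X\<close> as a left factor, each product is an index shift
      that the simplifier can evaluate coefficientwise.\<close>
    have expand: "?F * ?D = ?F - fps_const (p\<^sup>2 + 4 * q) * (fps_X * ?F)
        + fps_const (4 * q\<^sup>2) * (fps_X * (fps_X * ?F))"
      by (simp add: algebra_simps power2_eq_square)
    consider "n = 0" | "n = 1" | m where "n = Suc (Suc m)"
      by (metis One_nat_def not0_implies_Suc)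
    then show "fps_nth (?F * ?D) n = fps_nth ?N n"
    proof cases
      case 1
      then show ?thesis by (simp add: fps_numeral_nth)
    next
      case 2
      then show ?thesis
        unfolding expand by (simp add: fps_numeral_nth eval_nat_numeral algebra_simps)
    next
      case 3
      then show ?thesis
        \<comment> \<open>Degree m + 2 involves the terms of index 2m + 4, 2m + 2 and 2m, hence the
          instance at \<open>2 * m\<close>.\<close>
        unfolding expand using jacobsthal_lucas_add_4[of p q "2 * m"]
        by (simp add: fps_numeral_nth eval_nat_numeral)
    qed
  qed
  \<comment> \<open>Needed to cancel \<open>?D\<close> in the quotient; its constant coefficient is
    1.\<close>
  moreover have "?D \<noteq> 0"
  proof
    assume "?D = 0"
    then have "fps_nth ?D 0 = 0" by (simp only: fps_zero_nth)
    then show False by simp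
  qed
  ultimately show ?thesis
    by (metis nonzero_mult_div_cancel_right)
qed

end
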